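(* Let $X,Y$ be Banach spaces, $U$ an open subset of $X$, $f:U\to Y$ a continuous map and $Jf$ a pseudo-Jacobian mapping for $f$ on $U$ satisfying the chain rule condition on $U$. If $Jf$ is regular at a point $x\in U$, then for every $0<\alpha<\alpha_{Jf}(x)$ there exists an open ball $B(x,r)\subseteq U$ with the following properties: (1) the set $V:=f(B(x,r))$ is open in $Y$; (2) the map $f|_{B(x,r)}:B(x,r)\to V$ is a homeomorphism; (3) the map $(f|_{B(x,r)})^{-1}$ is $\alpha^{-1}$-Lipschitz on $V$.
   Context: Banach spaces are real; $\mathcal{L}(X,Y)$ is the space of bounded linear operators from $X$ to $Y$; $B(x,r)$ denotes the open ball; $\mathrm{co}$ denotes convex hull. For $\varphi:U\to\mathbb{R}$ with $U\subset X$ open, $x\in U$ and $v\in X$, $\varphi'_{+}(x;v)=\limsup_{t\to0^+}\frac{\varphi(x+tv)-\varphi(x)}{t}$. For a map $f:U\to Y$ and $x\in U$, a nonempty set $Jf(x)\subset\mathcal{L}(X,Y)$ is a pseudo-Jacobian of $f$ at $x$ if $(y^*\circ f)'_{+}(x;v)\le\sup\{\langle y^*,T(v)\rangle : T\in Jf(x)\}$ for all $y^*\in Y^*$ and $v\in X$. (For real-valued functions, pseudo-Jacobians are subsets of $X^*$.) A set-valued mapping $Jf:U\to2^{\mathcal{L}(X,Y)}$ is a pseudo-Jacobian mapping for $f$ on $U$ if $Jf(x)$ is a pseudo-Jacobian of $f$ at $x$ for every $x\in U$. For $A\subset U$, $Jf(A)=\{T : T\in Jf(z),\ z\in A\}$.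 Chain rule condition: for $y\in Y$ let $d_y(v)=\|v-y\|$, $v\in Y$, and let $\partial d_y(v)$ be its Clarke subdifferential (which, $d_y$ being convex and Lipschitz, is the convex subdifferential $\{y^*\in Y^* : \|w-y\|\ge\|v-y\|+\langle y^*,w-v\rangle\ \forall w\in Y\}$). For $x\in U$, $y\in Y$, $y\ne f(x)$, let $A_{x,y}(f)=\{y^*\circ T : y^*\in\partial d_y(f(x)),\ T\in\overline{\mathrm{co}}(Jf(x))\}\subset X^*$, where $\overline{\mathrm{co}}$ is the operator-norm closed convex hull. $Jf$ satisfies the chain rule condition on $U$ if for each $x\in U$ and each $y\in Y$ with $y\neq f(x)$, the set $A_{x,y}(f)$ is a $w^*$-closed and convex pseudo-Jacobian of $d_y\circ f$ at $x$. Regularity: for $T\in\mathcal{L}(X,Y)$ put $c(T)=\inf_{\|x\|=1}\|Tx\|$ (co-norm). The regularity index of $Jf$ at $x$ is $\alpha_{Jf}(x)=\sup_{r>0}\inf\{c(T) : T\in\mathrm{co}\,Jf(B(x,r))\}$ (over $r$ with $B(x,r)\subset U$). $Jf$ is regular at $x$ if for some $r>0$ every $T\in\mathrm{co}\,Jf(B(x,r))$ is an isomorphism (bounded linear bijection from $X$ onto $Y$ with bounded inverse) and $\alpha_{Jf}(x)>0$. *)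

theory Defs
  imports "HOL-Analysis.Analysis"
begin

text \<open>
  A map on an open set \<open>U\<close> is represented by a total function; all notions below depend only on
  its values near points of \<open>U\<close>. Suprema, infima and upper limits are taken in \<open>ereal\<close>, as
  pseudo-Jacobians may be unbounded.
\<close>

definition upper_dini :: "('a::real_normed_vector \<Rightarrow> real) \<Rightarrow> 'a \<Rightarrow> 'a \<Rightarrow> ereal" where
  "upper_dini \<phi> x v = Limsup (at_right 0) (\<lambda>t. ereal ((\<phi> (x + t *\<^sub>R v) - \<phi> x) / t))"

text \<open>For a real-valued map, instantiate \<open>'b = real\<close>: the pseudo-Jacobian is then a subset of the
  dual space \<open>'a \<Rightarrow>\<^sub>L real\<close>.\<close>

definition pseudo_Jacobian ::
  "('a::real_normed_vector \<Rightarrow> 'b::real_normed_vector) \<Rightarrow> 'a \<Rightarrow> ('a \<Rightarrow>\<^sub>L 'b) set \<Rightarrow> bool" where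
  "pseudo_Jacobian f x J \<longleftrightarrow> J \<noteq> {} \<and>
     (\<forall>(ystar :: 'b \<Rightarrow>\<^sub>L real) v.
        upper_dini (blinfun_apply ystar \<circ> f) x v \<le> (SUP T\<in>J. ereal (blinfun_apply ystar (blinfun_apply T v))))"

definition pseudo_Jacobian_mapping ::
  "'a::real_normed_vector set \<Rightarrow> ('a \<Rightarrow> 'b::real_normed_vector)
     \<Rightarrow> ('a \<Rightarrow> ('a \<Rightarrow>\<^sub>L 'b) set) \<Rightarrow> bool" where
  "pseudo_Jacobian_mapping U f Jf \<longleftrightarrow> (\<forall>x\<in>U. pseudo_Jacobian f x (Jf x))"

text \<open>In Clarke's upper limit over \<open>z \<rightarrow> x\<close>, \<open>t \<rightarrow> 0+\<close> the base point \<open>z = x\<close> is admitted, hence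
  \<open>nhds x\<close> rather than \<open>at x\<close>.\<close>

definition Clarke_derivative :: "('a::real_normed_vector \<Rightarrow> real) \<Rightarrow> 'a \<Rightarrow> 'a \<Rightarrow> ereal" where
  "Clarke_derivative \<phi> x v =
     Limsup (nhds x \<times>\<^sub>F at_right 0) (\<lambda>(z, t). ereal ((\<phi> (z + t *\<^sub>R v) - \<phi> z) / t))"

definition Clarke_subdifferential ::
  "('a::real_normed_vector \<Rightarrow> real) \<Rightarrow> 'a \<Rightarrow> ('a \<Rightarrow>\<^sub>L real) set" where
  "Clarke_subdifferential \<phi> x = {p. \<forall>v. ereal (blinfun_apply p v) \<le> Clarke_derivative \<phi> x v}"

text \<open>The distance function is convex and Lipschitz, so its Clarke subdifferential is the convex
  subdifferential.\<close>

lemma Clarke_subdifferential_norm_eq: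
  fixes y v :: "'a::real_normed_vector"
  shows "Clarke_subdifferential (\<lambda>u. norm (u - y)) v =
    {p. \<forall>w. norm (w - y) \<ge> norm (v - y) + blinfun_apply p (w - v)}"
proof -
  define d where "d = (\<lambda>u. norm (u - y))"
  have slope: "(d (z + t *\<^sub>R h) - d z) / t \<le> d (z + h) - d z"
    if "0 < t" "t \<le> 1" for z h :: 'a and t :: real
  proof -
    have "z + t *\<^sub>R h - y = (1 - t) *\<^sub>R (z - y) + t *\<^sub>R (z + h - y)"
      by (simp add: algebra_simps)
    then have "d (z + t *\<^sub>R h) \<le> norm ((1 - t) *\<^sub>R (z - y)) + norm (t *\<^sub>R (z + h - y))"
      unfolding d_def by (metis norm_triangle_ineq)
    also have "\<dots> = (1 - t) * d z + t * d (z + h)"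
      using that by (simp add: d_def)
    finally show ?thesis
      using that by (simp add: field_simps)
  qed
  have upper: "Clarke_derivative d v h \<le> ereal (d (v + h) - d v)" for h
  proof -
    let ?F = "nhds v \<times>\<^sub>F at_right (0::real)"
    have nontriv: "?F \<noteq> bot"
      by (simp add: prod_filter_eq_bot)
    have pos: "\<forall>\<^sub>F t in at_right (0::real). 0 < t \<and> t \<le> 1"
      by (rule eventually_at_rightI[of 0 1]) auto
    have "\<forall>\<^sub>F q in ?F. 0 < snd q \<and> snd q \<le> 1"
      by (rule eventually_compose_filterlim[OF pos filterlim_snd])
    then have le: "\<forall>\<^sub>F q in ?F. (case q of (z, t) \<Rightarrow> ereal ((d (z + t *\<^sub>R h) - d z) / t))
        \<le> ereal (d (fst q + h) - d (fst q))"
      by eventually_elim (auto simp: slope)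
    have "filterlim fst (nhds v) ?F"
      by (rule filterlim_fst)
    then have "((\<lambda>q. ereal (d (fst q + h) - d (fst q))) \<longlongrightarrow> ereal (d (v + h) - d v)) ?F"
      unfolding d_def by (intro tendsto_intros)
    then have "Limsup ?F (\<lambda>q. ereal (d (fst q + h) - d (fst q))) = ereal (d (v + h) - d v)"
      by (rule lim_imp_Limsup[OF nontriv])
    with Limsup_mono[OF le] show ?thesis
      by (simp add: Clarke_derivative_def)
  qed
  have lower: "ereal (p h) \<le> Clarke_derivative d v h"
    if p: "\<And>w. d w \<ge> d v + p (w - v)" for p :: "'a \<Rightarrow>\<^sub>L real" and h
    unfolding Clarke_derivative_def Limsup_def
  proof (rule INF_greatest)
    fix R assume "R \<in> {R. eventually R (nhds v \<times>\<^sub>F at_right (0::real))}"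
    then obtain P Q where P: "eventually P (nhds v)" and Q: "eventually Q (at_right (0::real))"
      and PQ: "\<And>z t. P z \<Longrightarrow> Q t \<Longrightarrow> R (z, t)"
      by (auto simp: eventually_prod_filter)
    from P have "P v" by (rule eventually_nhds_x_imp_x)
    have "\<forall>\<^sub>F t in at_right (0::real). 0 < t \<and> Q t"
      using Q by (intro eventually_conj eventually_at_right_less)
    then obtain t where t: "0 < t" "Q t"
      using eventually_happens'[OF trivial_limit_at_right_real] by blast
    have "d (v + t *\<^sub>R h) \<ge> d v + t * p h"
      using p[of "v + t *\<^sub>R h"] by (simp add: blinfun.scaleR_right)
    then have "ereal (p h) \<le> (case (v, t) of (z, t) \<Rightarrow> ereal ((d (z + t *\<^sub>R h) - d z) / t))"
      using t by (simp add: field_simps)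
    also have "\<dots> \<le> (SUP q\<in>{q. R q}. case q of (z, t) \<Rightarrow> ereal ((d (z + t *\<^sub>R h) - d z) / t))"
      using PQ[OF \<open>P v\<close> \<open>Q t\<close>] by (intro SUP_upper) simp
    finally show "ereal (p h) \<le> \<dots>" .
  qed
  have "Clarke_subdifferential d v = {p. \<forall>w. d w \<ge> d v + blinfun_apply p (w - v)}"
  proof (intro equalityI subsetI CollectI allI)
    fix p w assume "p \<in> Clarke_subdifferential d v"
    then have "ereal (p (w - v)) \<le> Clarke_derivative d v (w - v)"
      by (simp add: Clarke_subdifferential_def)
    also have "\<dots> \<le> ereal (d (v + (w - v)) - d v)"
      by (rule upper)
    finally show "d w \<ge> d v + p (w - v)" by simp
  qed (use lower in \<open>auto simp: Clarke_subdifferential_def\<close>)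
  then show ?thesis by (simp add: d_def)
qed

text \<open>The weak-* topology on the dual is the topology of pointwise convergence, i.e. the strong
  operator topology for scalar-valued operators.\<close>

definition weak_star_topology :: "('a::real_normed_vector \<Rightarrow>\<^sub>L real) topology" where
  "weak_star_topology = strong_operator_topology"

definition chain_set ::
  "('a::real_normed_vector \<Rightarrow> 'b::real_normed_vector) \<Rightarrow> ('a \<Rightarrow> ('a \<Rightarrow>\<^sub>L 'b) set)
     \<Rightarrow> 'a \<Rightarrow> 'b \<Rightarrow> ('a \<Rightarrow>\<^sub>L real) set" where
  "chain_set f Jf x y = {ystar o\<^sub>L T | ystar T.
     ystar \<in> Clarke_subdifferential (\<lambda>v. norm (v - y)) (f x) \<and> T \<in> closure (convex hull Jf x)}"

definition chain_rule_condition ::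
  "'a::real_normed_vector set \<Rightarrow> ('a \<Rightarrow> 'b::real_normed_vector)
     \<Rightarrow> ('a \<Rightarrow> ('a \<Rightarrow>\<^sub>L 'b) set) \<Rightarrow> bool" where
  "chain_rule_condition U f Jf \<longleftrightarrow>
     (\<forall>x\<in>U. \<forall>y. y \<noteq> f x \<longrightarrow>
        closedin weak_star_topology (chain_set f Jf x y) \<and>
        convex (chain_set f Jf x y) \<and>
        pseudo_Jacobian ((\<lambda>v. norm (v - y)) \<circ> f) x (chain_set f Jf x y))"

definition conorm :: "('a::real_normed_vector \<Rightarrow>\<^sub>L 'b::real_normed_vector) \<Rightarrow> ereal" where
  "conorm T = (INF x\<in>{x. norm x = 1}. ereal (norm (T x)))"

definition regularity_index ::
  "'a::real_normed_vector set \<Rightarrow> ('a \<Rightarrow> ('a \<Rightarrow>\<^sub>L 'b::real_normed_vector) set) \<Rightarrow> 'a \<Rightarrow> ereal" where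
  "regularity_index U Jf x =
     (SUP r\<in>{r. r > 0 \<and> ball x r \<subseteq> U}. INF T\<in>convex hull (\<Union>z\<in>ball x r. Jf z). conorm T)"

definition Banach_isomorphism :: "('a::real_normed_vector \<Rightarrow>\<^sub>L 'b::real_normed_vector) \<Rightarrow> bool" where
  "Banach_isomorphism T \<longleftrightarrow> bij (blinfun_apply T) \<and> bounded_linear (inv (blinfun_apply T))"

definition regular_at ::
  "'a::real_normed_vector set \<Rightarrow> ('a \<Rightarrow> ('a \<Rightarrow>\<^sub>L 'b::real_normed_vector) set) \<Rightarrow> 'a \<Rightarrow> bool" where
  "regular_at U Jf x \<longleftrightarrow>
     (\<exists>r>0. ball x r \<subseteq> U \<and> (\<forall>T\<in>convex hull (\<Union>z\<in>ball x r. Jf z). Banach_isomorphism T)) \<and>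
     regularity_index U Jf x > 0"

end

theory Submission
  imports Defs
begin

text \<open>
  Fix \<open>\<alpha>\<close> below the regularity index. On a small ball \<open>B\<close> around \<open>x\<close> every operator \<open>T\<close> in the convex
  hull of the values of \<open>Jf\<close> is onto and satisfies \<open>\<parallel>T v\<parallel> \<ge> \<beta> \<parallel>v\<parallel>\<close> with one constant \<open>\<beta> > \<alpha>\<close>. Two
  arguments, one for each half of the conclusion, turn this into statements about \<open>f\<close>.

  Expansion, \<open>\<parallel>f w - f u\<parallel> \<ge> \<beta> \<parallel>w - u\<parallel>\<close> on \<open>B\<close> (\<open>pseudo_Jacobian_expansion\<close>). The set of all
  \<open>T (w - u)\<close> is convex and lies outside the ball of radius \<open>\<beta> \<parallel>w - u\<parallel>\<close>. A functional separating the
  two is bounded below on this set, so the scalar mean value inequality applies to its composite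
  with \<open>f\<close>. Hence \<open>f\<close> is injective on \<open>B\<close> with a Lipschitz inverse of constant \<open>1 / \<alpha>\<close>.

  Openness, \<open>ball (f z) (\<alpha> \<rho>) \<subseteq> f (ball z \<rho>)\<close> whenever the closed ball of radius \<open>\<rho>\<close> around \<open>z\<close> lies in
  \<open>B\<close> (\<open>linear_openness\<close>). To solve \<open>f w = y\<close>, consider \<open>g = \<parallel>f - y\<parallel>\<close>. Where \<open>g\<close> is nonzero, the chain
  rule condition provides a weak-* closed convex pseudo-Jacobian of \<open>g\<close>, all of whose elements have
  norm at least \<open>\<beta>\<close> (\<open>chain_set_norm_ge\<close>). By weak-* compactness of dual balls it is separated from a
  smaller ball by a vector of the space (\<open>weak_star_separate_from_ball\<close>), and the opposite vector is a
  direction in which \<open>g\<close> decreases faster than at rate \<open>\<alpha>\<close>. Ekeland's principle yields a point of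
  \<open>ball z \<rho>\<close> where such a decrease is impossible; there \<open>g\<close> must vanish.

  Both separations rest on the Mazur--Orlicz form of the Hahn--Banach theorem
  (\<open>Mazur_Orlicz\<close>): for a convex set \<open>C\<close> on which a sublinear \<open>p\<close> is at least \<open>s\<close>, some linear functional
  below \<open>p\<close> is still at least \<open>s\<close> on \<open>C\<close>.
\<close>

section \<open>Linear functionals below a sublinear functional\<close>

definition sublinear :: "('a::real_vector \<Rightarrow> real) \<Rightarrow> bool" where
  "sublinear p \<longleftrightarrow> (\<forall>x y. p (x + y) \<le> p x + p y) \<and> (\<forall>t\<ge>0. \<forall>x. p (t *\<^sub>R x) = t * p x)"

lemma sublinear_add: "sublinear p \<Longrightarrow> p (x + y) \<le> p x + p y"
  and sublinear_scaleR: "sublinear p \<Longrightarrow> 0 \<le> t \<Longrightarrow> p (t *\<^sub>R x) = t * p x"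
  by (auto simp: sublinear_def)

lemma sublinear_zero: "sublinear p \<Longrightarrow> p 0 = 0"
  using sublinear_scaleR[of p 0 0] by simp

lemma sublinear_minus: "sublinear p \<Longrightarrow> - p (- x) \<le> p x"
  using sublinear_add[of p x "- x"] sublinear_zero[of p] by simp

text \<open>An infimum of functions is sublinear when subadditivity and homogeneity hold after passing to
  a suitable third member of the family. The members themselves need not be sublinear. All
  sublinear functionals built below arise in this way.\<close>
lemma sublinear_INF:
  fixes G :: "'i \<Rightarrow> 'a::real_vector \<Rightarrow> real"
  assumes "I \<noteq> {}"
    and bdd: "\<And>x. bdd_below ((\<lambda>i. G i x) ` I)"
    and add: "\<And>i j x y. i \<in> I \<Longrightarrow> j \<in> I \<Longrightarrow> \<exists>k\<in>I. G k (x + y) \<le> G i x + G j y"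
    and scale: "\<And>i t x. i \<in> I \<Longrightarrow> 0 < t \<Longrightarrow> \<exists>k\<in>I. G k (t *\<^sub>R x) \<le> t * G i x"
  shows "sublinear (\<lambda>x. INF i\<in>I. G i x)"
proof -
  define q where "q = (\<lambda>x. INF i\<in>I. G i x)"
  have lower: "q x \<le> G i x" if "i \<in> I" for i x
    unfolding q_def using bdd that by (rule cINF_lower)
  have greatest: "c \<le> q x" if "\<And>i. i \<in> I \<Longrightarrow> c \<le> G i x" for c x
    unfolding q_def using \<open>I \<noteq> {}\<close> that by (rule cINF_greatest)
  have "q (x + y) \<le> q x + q y" for x y
  proof -
    have "q (x + y) - G j y \<le> G i x" if "i \<in> I" "j \<in> I" for i j
      using add[OF that, of x y] lower by (smt (verit))
    then have "q (x + y) - G j y \<le> q x" if "j \<in> I" for j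
      using greatest that by blast
    then have "q (x + y) - q x \<le> q y"
      by (intro greatest) (simp add: algebra_simps)
    then show ?thesis by simp
  qed
  moreover have le: "q (t *\<^sub>R x) \<le> t * q x" if "0 < t" for t x
  proof -
    have "q (t *\<^sub>R x) / t \<le> G i x" if "i \<in> I" for i
    proof -
      have "q (t *\<^sub>R x) \<le> t * G i x"
        using scale[OF that \<open>0 < t\<close>, of x] lower by (meson order_trans)
      then show ?thesis
        using \<open>0 < t\<close> by (simp add: field_simps)
    qed
    then have "q (t *\<^sub>R x) / t \<le> q x" by (rule greatest)
    then show ?thesis using \<open>0 < t\<close> by (simp add: field_simps)
  qed
  moreover have "t * q x \<le> q (t *\<^sub>R x)" if "0 < t" for t x
    using le[of "inverse t" "t *\<^sub>R x"] that by (simp add: field_simps)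
  moreover have "q 0 = 0"
    using le[of 2 0] le[of "1/2" 0] by simp
  ultimately show ?thesis
    unfolding sublinear_def q_def[symmetric] by (metis antisym mult_zero_left order_le_less scaleR_zero_left)
qed

text \<open>A functional \<open>q\<close> with \<open>q (- c) \<le> - s\<close> on \<open>C\<close> forces every linear functional below it to be at
  least \<open>s\<close> on \<open>C\<close>. The one constructed here is
  \<open>q x = inf {p (x + t c) - t s | t \<ge> 0, c \<in> C}\<close>: the infimum is finite because \<open>s \<le> p\<close> on \<open>C\<close>, and
  it is sublinear because \<open>C\<close> is convex.\<close>
lemma sublinear_lower_envelope:
  assumes p: "sublinear p" and "convex C" "C \<noteq> {}" and s: "\<And>c. c \<in> C \<Longrightarrow> s \<le> p c"
  obtains q where "sublinear q" "\<And>x. q x \<le> p x" "\<And>x c. c \<in> C \<Longrightarrow> q x \<le> p (x + c) - s"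
proof -
  define G where "G = (\<lambda>(t, c) x. p (x + t *\<^sub>R c) - t * s)"
  define I where "I = {0::real..} \<times> C"
  have bound: "- p (- x) \<le> G i x" if "i \<in> I" for i x
  proof -
    obtain t c where i: "i = (t, c)" "0 \<le> t" "c \<in> C"
      using \<open>i \<in> I\<close> by (auto simp: I_def)
    have "t * s \<le> p (t *\<^sub>R c)"
      using s[OF i(3)] sublinear_scaleR[OF p i(2)] i(2) by (simp add: mult_left_mono)
    also have "\<dots> \<le> p (x + t *\<^sub>R c) + p (- x)"
      using sublinear_add[OF p, of "x + t *\<^sub>R c" "- x"] by simp
    finally show ?thesis by (simp add: G_def i(1))
  qed
  have bdd: "bdd_below ((\<lambda>i. G i x) ` I)" for x
    using bound by (intro bdd_belowI2[where m = "- p (- x)"])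
  define q where "q = (\<lambda>x. INF i\<in>I. G i x)"
  have le: "q x \<le> G i x" if "i \<in> I" for i x
    unfolding q_def using bdd that by (rule cINF_lower)
  have "sublinear q"
    unfolding q_def
  proof (rule sublinear_INF)
    show "I \<noteq> {}" using \<open>C \<noteq> {}\<close> by (auto simp: I_def)
    show "\<exists>k\<in>I. G k (x + y) \<le> G i x + G j y" if "i \<in> I" "j \<in> I" for i j x y
    proof -
      obtain t c u d where ij: "i = (t, c)" "0 \<le> t" "c \<in> C" "j = (u, d)" "0 \<le> u" "d \<in> C"
        using \<open>i \<in> I\<close> \<open>j \<in> I\<close> by (auto simp: I_def)
      \<comment> \<open>The convex combination of \<open>c\<close> and \<open>d\<close> with weights proportional to \<open>t\<close> and \<open>u\<close>.\<close>
      obtain e where e: "e \<in> C" "(t + u) *\<^sub>R e = t *\<^sub>R c + u *\<^sub>R d"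
      proof (cases "t + u = 0")
        case True
        then have "t = 0" "u = 0" using ij by auto
        with that ij show ?thesis by auto
      next
        case False
        define e where "e = (t / (t + u)) *\<^sub>R c + (u / (t + u)) *\<^sub>R d"
        have "e \<in> C"
          unfolding e_def using ij False
          by (intro convexD[OF \<open>convex C\<close>]) (auto simp: add_divide_distrib[symmetric])
        moreover have "(t + u) *\<^sub>R e = t *\<^sub>R c + u *\<^sub>R d"
          using False by (simp add: e_def scaleR_add_right)
        ultimately show ?thesis by (rule that)
      qed
      have "(x + y) + (t + u) *\<^sub>R e = (x + t *\<^sub>R c) + (y + u *\<^sub>R d)"
        using e by simp
      then have "G (t + u, e) (x + y) \<le> G i x + G j y"
        using sublinear_add[OF p, of "x + t *\<^sub>R c" "y + u *\<^sub>R d"]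
        by (simp add: G_def ij(1,4) algebra_simps)
      then show ?thesis using ij e by (intro bexI[of _ "(t + u, e)"]) (auto simp: I_def)
    qed
    show "\<exists>k\<in>I. G k (t *\<^sub>R x) \<le> t * G i x" if "i \<in> I" "0 < t" for i t x
    proof -
      obtain u c where i: "i = (u, c)" "0 \<le> u" "c \<in> C"
        using \<open>i \<in> I\<close> by (auto simp: I_def)
      have "G (t * u, c) (t *\<^sub>R x) = t * G i x"
        using sublinear_scaleR[OF p, of t "x + u *\<^sub>R c"] \<open>0 < t\<close>
        by (simp add: G_def i(1) algebra_simps)
      then show ?thesis using i \<open>0 < t\<close> by (intro bexI[of _ "(t * u, c)"]) (auto simp: I_def)
    qed
  qed (rule bdd)
  moreover have "q x \<le> p x" for x
    using le[of "(0, SOME c. c \<in> C)" x] \<open>C \<noteq> {}\<close> by (auto simp: G_def I_def some_in_eq)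
  moreover have "q x \<le> p (x + c) - s" if "c \<in> C" for x c
    using le[of "(1, c)" x] that by (simp add: G_def I_def)
  ultimately show ?thesis by (rule that)
qed

text \<open>Zorn's lemma, downwards: the pointwise infimum of a chain is finite since every sublinear
  \<open>q \<le> p\<close> satisfies \<open>- p (- x) \<le> q x\<close>.\<close>
lemma minimal_sublinear_exists:
  assumes p: "sublinear p"
  obtains m where "sublinear m" "\<And>x. m x \<le> p x"
    "\<And>q. sublinear q \<Longrightarrow> (\<And>x. q x \<le> m x) \<Longrightarrow> q = m"
proof -
  define S where "S = {q. sublinear q \<and> q \<le> p}"
  have po: "partial_order_on S (relation_of (\<ge>) S)"
    by (auto simp: partial_order_on_def preorder_on_def refl_on_def trans_def antisym_def
      relation_of_def)
  have "\<exists>m\<in>S. \<forall>q\<in>S. m \<ge> q \<longrightarrow> q = m"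
  proof (rule predicate_Zorn[OF po])
    fix K assume K: "K \<in> Chains (relation_of (\<ge>) S)"
    have sub: "sublinear q" "q \<le> p" if "q \<in> K" for q
      using K that by (auto simp: Chains_def relation_of_def S_def)
    have total: "q \<le> q' \<or> q' \<le> q" if "q \<in> K" "q' \<in> K" for q q'
      using K that by (auto simp: Chains_def relation_of_def)
    show "\<exists>u\<in>S. \<forall>q\<in>K. q \<ge> u"
    proof (cases "K = {}")
      case True
      then show ?thesis using p by (auto simp: S_def)
    next
      case False
      have bdd: "bdd_below ((\<lambda>q. q x) ` K)" for x
      proof (rule bdd_belowI2[where m = "- p (- x)"])
        fix q assume "q \<in> K"
        then have "q (- x) \<le> p (- x)" using sub by (simp add: le_fun_def)
        then show "- p (- x) \<le> q x"
          using sublinear_minus[OF sub(1)[OF \<open>q \<in> K\<close>], of x] by simp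
      qed
      define u where "u = (\<lambda>x. INF q\<in>K. q x)"
      have le: "u x \<le> q x" if "q \<in> K" for q x
        unfolding u_def using bdd that by (rule cINF_lower)
      have "sublinear u"
        unfolding u_def
      proof (rule sublinear_INF[OF False bdd])
        show "\<exists>k\<in>K. k (x + y) \<le> q x + r y" if "q \<in> K" "r \<in> K" for q r x y
        proof -
          obtain k where "k \<in> K" "k \<le> q" "k \<le> r"
            using total[OF \<open>q \<in> K\<close> \<open>r \<in> K\<close>] \<open>q \<in> K\<close> \<open>r \<in> K\<close> by (metis order_refl)
          have "k (x + y) \<le> k x + k y" using \<open>k \<in> K\<close> by (intro sublinear_add sub(1))
          also have "\<dots> \<le> q x + r y"
            using \<open>k \<le> q\<close> \<open>k \<le> r\<close> by (intro add_mono) (auto simp: le_fun_def)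
          finally show ?thesis using \<open>k \<in> K\<close> by blast
        qed
        show "\<exists>k\<in>K. k (t *\<^sub>R x) \<le> t * q x" if "q \<in> K" "0 < t" for q x t
          using sublinear_scaleR[OF sub(1)] that by (intro bexI[of _ q]) auto
      qed
      moreover obtain q where "q \<in> K" using False by blast
      then have "u \<le> p" using le sub(2) by (meson le_fun_def order_trans)
      ultimately show ?thesis
        using le by (intro bexI[of _ u]) (auto simp: S_def le_fun_def)
    qed
  qed
  then obtain m where "m \<in> S" and min: "\<And>q. q \<in> S \<Longrightarrow> q \<le> m \<Longrightarrow> q = m" by blast
  show ?thesis
  proof (rule that)
    show "sublinear m" "m x \<le> p x" for x
      using \<open>m \<in> S\<close> by (auto simp: S_def le_fun_def)
    show "q = m" if "sublinear q" "\<And>x. q x \<le> m x" for q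
      using that \<open>m \<in> S\<close> order_trans[of q m p] by (intro min) (auto simp: S_def le_fun_def)
  qed
qed

text \<open>The form of the Hahn--Banach theorem used throughout. Below the lower envelope of \<open>p\<close> that
  encodes the constraint on \<open>C\<close>, choose a minimal sublinear functional \<open>m\<close>. Minimality makes \<open>m\<close>
  linear: the lower envelope of \<open>m\<close> for the set \<open>{y}\<close> and the bound \<open>m y\<close> lies below \<open>m\<close>, hence equals
  it, and this reads \<open>m x \<le> m (x + y) - m y\<close>, the missing half of additivity.\<close>
theorem Mazur_Orlicz:
  assumes p: "sublinear p" and C: "convex C" "C \<noteq> {}" and s: "\<And>c. c \<in> C \<Longrightarrow> s \<le> p c"
  obtains \<phi> where "linear \<phi>" "\<And>x. \<phi> x \<le> p x" "\<And>c. c \<in> C \<Longrightarrow> s \<le> \<phi> c"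
proof -
  obtain q where q: "sublinear q" "\<And>x. q x \<le> p x" "\<And>x c. c \<in> C \<Longrightarrow> q x \<le> p (x + c) - s"
    using sublinear_lower_envelope[OF p C s] by blast
  obtain m where m: "sublinear m" "\<And>x. m x \<le> q x"
    and min: "\<And>r. sublinear r \<Longrightarrow> (\<And>x. r x \<le> m x) \<Longrightarrow> r = m"
    using minimal_sublinear_exists[OF q(1)] by blast
  have add: "m (x + y) = m x + m y" for x y
  proof -
    obtain r where "sublinear r" "\<And>x. r x \<le> m x" "\<And>x. r x \<le> m (x + y) - m y"
      using sublinear_lower_envelope[OF m(1), of "{y}" "m y"] by auto
    with min[of r] have "m x \<le> m (x + y) - m y" by simp
    then show ?thesis using sublinear_add[OF m(1), of x y] by simp
  qed
  have neg: "m (- x) = - m x" for x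
    using add[of x "- x"] sublinear_zero[OF m(1)] by simp
  have "m (t *\<^sub>R x) = t *\<^sub>R m x" for t x
    using sublinear_scaleR[OF m(1), of t x] sublinear_scaleR[OF m(1), of "- t" x]
      neg[of "t *\<^sub>R x"] by (cases "0 \<le> t") auto
  then have "linear m" using add by (intro linearI)
  moreover have "m x \<le> p x" for x using m q by (meson order_trans)
  moreover have "s \<le> m c" if "c \<in> C" for c
    using m(2)[of "- c"] q(3)[OF that, of "- c"] neg[of c] sublinear_zero[OF p] by simp
  ultimately show ?thesis by (rule that)
qed

lemma sublinear_norm: "sublinear norm"
  by (auto simp: sublinear_def norm_triangle_ineq)

lemma linear_le_norm_blinfun:
  fixes \<phi> :: "'a::real_normed_vector \<Rightarrow> real"
  assumes "linear \<phi>" "\<And>x. \<phi> x \<le> norm x"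
  obtains \<psi> :: "'a \<Rightarrow>\<^sub>L real" where "\<And>x. blinfun_apply \<psi> x = \<phi> x" "norm \<psi> \<le> 1"
proof -
  have b: "norm (\<phi> x) \<le> norm x * 1" for x
    using assms(2)[of x] assms(2)[of "- x"] linear_neg[OF assms(1), of x] by (simp add: abs_le_iff)
  then have "bounded_linear \<phi>"
    using linear_add[OF assms(1)] linear_scale[OF assms(1)] by (intro bounded_linear_intro)
  then have "Blinfun \<phi> x = \<phi> x" for x by (simp add: bounded_linear_Blinfun_apply)
  with b show ?thesis
    by (intro that[of "Blinfun \<phi>"]) (auto intro!: norm_blinfun_bound)
qed

text \<open>The dual unit ball norms every vector: apply the Mazur--Orlicz theorem to the norm and the
  set \<open>{v}\<close>.\<close>
lemma norm_le_if_dual_le: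
  fixes v :: "'a::real_normed_vector"
  assumes "\<And>\<psi> :: 'a \<Rightarrow>\<^sub>L real. blinfun_apply \<psi> v \<le> norm \<psi>"
  shows "norm v \<le> 1"
proof -
  obtain \<phi> where \<phi>: "linear \<phi>" "\<And>x. \<phi> x \<le> norm x" "norm v \<le> \<phi> v"
    using Mazur_Orlicz[OF sublinear_norm, of "{v}" "norm v"] by auto
  obtain \<psi> :: "'a \<Rightarrow>\<^sub>L real" where "\<And>x. blinfun_apply \<psi> x = \<phi> x" "norm \<psi> \<le> 1"
    using linear_le_norm_blinfun[OF \<phi>(1,2)] by blast
  with assms[of \<psi>] \<phi>(3) show ?thesis by simp
qed

lemma separate_from_ball:
  fixes C :: "'a::real_normed_vector set"
  assumes "convex C" "C \<noteq> {}" "\<And>c. c \<in> C \<Longrightarrow> s \<le> norm c"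
  obtains \<psi> :: "'a \<Rightarrow>\<^sub>L real" where "norm \<psi> \<le> 1" "\<And>c. c \<in> C \<Longrightarrow> s \<le> blinfun_apply \<psi> c"
proof -
  obtain \<phi> where \<phi>: "linear \<phi>" "\<And>x. \<phi> x \<le> norm x" "\<And>c. c \<in> C \<Longrightarrow> s \<le> \<phi> c"
    using Mazur_Orlicz[OF sublinear_norm assms] by auto
  obtain \<psi> :: "'a \<Rightarrow>\<^sub>L real" where "\<And>x. blinfun_apply \<psi> x = \<phi> x" "norm \<psi> \<le> 1"
    using linear_le_norm_blinfun[OF \<phi>(1,2)] by blast
  with \<phi>(3) show ?thesis by (intro that[of \<psi>]) auto
qed

section \<open>Separation by a vector in the weak-* topology\<close>

lemma open_fun_contains_box:
  fixes W :: "('a \<Rightarrow> real) set"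
  assumes "open W" "k \<in> W"
  obtains F e where "finite F" "0 < e" "\<And>g. (\<And>v. v \<in> F \<Longrightarrow> \<bar>g v - k v\<bar> < e) \<Longrightarrow> g \<in> W"
proof -
  have "openin (product_topology (\<lambda>_. euclidean) UNIV) W"
    using \<open>open W\<close> by (simp add: euclidean_product_topology)
  from product_topology_open_contains_basis[OF this \<open>k \<in> W\<close>]
  obtain X where X: "k \<in> (\<Pi>\<^sub>E i\<in>UNIV. X i)" "\<forall>i. openin euclidean (X i)"
      "finite {i. X i \<noteq> topspace euclidean}" "(\<Pi>\<^sub>E i\<in>UNIV. X i) \<subseteq> W"
    by (elim exE conjE) (rule that)
  have X_open: "open (X i)" for i using X(2) by simp
  have "\<exists>e>0. ball (k i) e \<subseteq> X i" for i
  proof -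
    have "k i \<in> X i" using X(1) by blast
    with X_open[of i] show ?thesis by (meson open_contains_ball)
  qed
  then have "\<exists>e. \<forall>i. 0 < e i \<and> ball (k i) (e i) \<subseteq> X i" by (intro choice) blast
  then obtain e where e: "\<And>i. 0 < e i" "\<And>i. ball (k i) (e i) \<subseteq> X i" by blast
  define F where "F = {i. X i \<noteq> UNIV}"
  show ?thesis
  proof (rule that[of F "Min (insert 1 (e ` F))"])
    show "finite F" using X(3) by (simp add: F_def)
    then show "0 < Min (insert 1 (e ` F))" using e(1) by simp
    fix g :: "'a \<Rightarrow> real" assume g: "\<And>v. v \<in> F \<Longrightarrow> \<bar>g v - k v\<bar> < Min (insert 1 (e ` F))"
    have "g i \<in> X i" for i
    proof (cases "i \<in> F")
      case True
      then have "\<bar>g i - k i\<bar> < e i" using g[OF True] \<open>finite F\<close> by simp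
      then have "g i \<in> ball (k i) (e i)" by (simp add: dist_real_def)
      then show ?thesis using e(2)[of i] by blast
    qed (simp add: F_def)
    then show "g \<in> W" using X(4) by auto
  qed
qed

text \<open>Disjoint compact and closed sets of functions are already a positive distance apart on
  finitely many coordinates. Each point of the compact set has a basic neighbourhood whose double
  misses the closed set; finitely many of these neighbourhoods cover.\<close>
lemma compact_closed_uniform_box:
  fixes K C :: "('a \<Rightarrow> real) set"
  assumes "compact K" "closed C" "K \<inter> C = {}"
  obtains F e where "finite F" "0 < e"
    "\<And>k c. k \<in> K \<Longrightarrow> c \<in> C \<Longrightarrow> \<exists>v\<in>F. e \<le> \<bar>c v - k v\<bar>"
proof -
  have "\<exists>F e. finite F \<and> 0 < e \<and> (\<forall>g. (\<forall>v\<in>F. \<bar>g v - k v\<bar> < e) \<longrightarrow> g \<notin> C)" if "k \<in> K" for k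
  proof -
    have "open (- C)" "k \<in> - C" using assms that by auto
    then obtain F e where "finite F" "0 < e" "\<And>g. (\<And>v. v \<in> F \<Longrightarrow> \<bar>g v - k v\<bar> < e) \<Longrightarrow> g \<in> - C"
      by (rule open_fun_contains_box) blast
    then show ?thesis by (intro exI[of _ F] exI[of _ e]) auto
  qed
  then obtain F e where Fe: "\<And>k. k \<in> K \<Longrightarrow>
      finite (F k) \<and> 0 < e k \<and> (\<forall>g. (\<forall>v\<in>F k. \<bar>g v - k v\<bar> < e k) \<longrightarrow> g \<notin> C)"
    by metis
  then have F: "\<And>k. k \<in> K \<Longrightarrow> finite (F k)" "\<And>k. k \<in> K \<Longrightarrow> 0 < e k"
    "\<And>k g. k \<in> K \<Longrightarrow> (\<forall>v\<in>F k. \<bar>g v - k v\<bar> < e k) \<Longrightarrow> g \<notin> C"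
    by (simp_all add: Fe)
  define W where "W = (\<lambda>k. {g. \<forall>v\<in>F k. g v \<in> {k v - e k / 2 <..< k v + e k / 2}})"
  have "open (W k)" if "k \<in> K" for k
    unfolding W_def using F(1)[OF that]
    by (rule product_topology_basis'[where x = "\<lambda>v. v" and U = "\<lambda>v. {k v - e k / 2 <..< k v + e k / 2}"]) auto
  moreover have "K \<subseteq> (\<Union>k\<in>K. W k)"
  proof
    fix k assume "k \<in> K"
    then have "k \<in> W k" using F(2)[of k] by (simp add: W_def)
    with \<open>k \<in> K\<close> show "k \<in> (\<Union>k\<in>K. W k)" by blast
  qed
  ultimately obtain D where D: "D \<subseteq> K" "finite D" "K \<subseteq> (\<Union>k\<in>D. W k)"
    using compactE_image[OF \<open>compact K\<close>, of K W] by blast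
  define m where "m = Min (insert 1 ((\<lambda>k. e k / 2) ` D))"
  show ?thesis
  proof (rule that[of "\<Union>k\<in>D. F k" m])
    show "finite (\<Union>k\<in>D. F k)" using D F by auto
    show "0 < m" unfolding m_def using D F(2) by (auto simp: subset_iff)
    fix k c assume "k \<in> K" "c \<in> C"
    then obtain l where l: "l \<in> D" "k \<in> W l" using D by blast
    then have "l \<in> K" using D by blast
    with F(3)[of l c] \<open>c \<in> C\<close> obtain v where v: "v \<in> F l" "e l \<le> \<bar>c v - l v\<bar>"
      by (meson not_less)
    have "l v - e l / 2 < k v \<and> k v < l v + e l / 2"
      using l(2) v(1) by (auto simp: W_def)
    moreover have "m \<le> e l / 2"
      unfolding m_def using D l(1) by (intro Min_le) auto
    ultimately have "m \<le> \<bar>c v - k v\<bar>" using v(2) by linarith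
    then show "\<exists>v\<in>\<Union>k\<in>D. F k. m \<le> \<bar>c v - k v\<bar>" using v l by blast
  qed
qed

text \<open>The dual ball, as a set of functions, is cut out of the compact product of the intervals
  \<open>[- s \<parallel>v\<parallel>, s \<parallel>v\<parallel>]\<close> by the linearity equations, each of which is closed in the topology of
  pointwise convergence.\<close>
lemma Banach_Alaoglu:
  "compact (blinfun_apply ` cball (0 :: 'a::real_normed_vector \<Rightarrow>\<^sub>L real) s)"
proof (cases "0 \<le> s")
  case s: True
  define P where "P = (\<Pi>\<^sub>E v\<in>(UNIV :: 'a set). {- s * norm v .. s * norm v})"
  define L where "L = (\<Inter>(x, y)\<in>UNIV. {g :: 'a \<Rightarrow> real. g (x + y) = g x + g y}) \<inter>
    (\<Inter>(t, x)\<in>UNIV. {g. g (t *\<^sub>R x) = t * g x})"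
  have "compactin (product_topology (\<lambda>_::'a. euclidean::real topology) UNIV) P"
    unfolding P_def compactin_PiE by simp
  then have "compact P" by (simp add: euclidean_product_topology)
  moreover have "closed {g :: 'a \<Rightarrow> real. g (x + y) = g x + g y}" for x y
    by (intro closed_Collect_eq continuous_on_add continuous_on_product_coordinates)
  moreover have "closed {g :: 'a \<Rightarrow> real. g (t *\<^sub>R x) = t * g x}" for t x
    by (intro closed_Collect_eq continuous_on_mult_left continuous_on_product_coordinates)
  ultimately have "compact P" "closed L"
    unfolding L_def by (auto intro!: closed_Int closed_INT)
  moreover have "blinfun_apply ` cball 0 s = L \<inter> P"
  proof (intro equalityI subsetI)
    fix g assume "g \<in> blinfun_apply ` cball (0 :: 'a \<Rightarrow>\<^sub>L real) s"
    then obtain \<psi> :: "'a \<Rightarrow>\<^sub>L real" where \<psi>: "g = blinfun_apply \<psi>" "norm \<psi> \<le> s" by auto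
    have "\<bar>\<psi> v\<bar> \<le> s * norm v" for v
      using norm_blinfun[of \<psi> v] \<psi>(2) by (metis mult_right_mono norm_ge_zero order_trans real_norm_def)
    then show "g \<in> L \<inter> P"
      by (auto simp: L_def P_def \<psi>(1) blinfun.add_right blinfun.scaleR_right abs_le_iff minus_le_iff)
  next
    fix g assume g: "g \<in> L \<inter> P"
    then have b: "norm (g v) \<le> s * norm v" for v
      by (auto simp: P_def PiE_iff abs_le_iff minus_le_iff)
    have "bounded_linear g"
      using g b by (intro bounded_linear_intro[where K = s]) (auto simp: L_def mult.commute)
    then have "blinfun_apply (Blinfun g) = g" by (simp add: bounded_linear_Blinfun_apply)
    moreover from this have "norm (Blinfun g) \<le> s"
      using b s by (intro norm_blinfun_bound) auto
    ultimately show "g \<in> blinfun_apply ` cball 0 s"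
      by (intro image_eqI[of _ _ "Blinfun g"]) auto
  qed
  ultimately show ?thesis by (simp add: closed_Int_compact)
qed auto

text \<open>A functional on the dual vanishing wherever finitely many evaluations vanish is a linear
  combination of them, hence itself an evaluation. When the evaluation at a further point \<open>w\<close> is
  independent of those in \<open>F\<close>, it can be split off by means of a \<open>\<xi>\<close> with \<open>\<xi> w = 1\<close> and \<open>\<xi> = 0\<close> on
  \<open>F\<close>.\<close>
lemma functional_of_finitely_many_evaluations:
  fixes \<Phi> :: "('a::real_normed_vector \<Rightarrow>\<^sub>L real) \<Rightarrow> real"
  assumes "finite F" "linear \<Phi>" "\<And>\<psi>. (\<And>v. v \<in> F \<Longrightarrow> blinfun_apply \<psi> v = 0) \<Longrightarrow> \<Phi> \<psi> = 0"
  obtains v where "\<And>\<psi>. \<Phi> \<psi> = blinfun_apply \<psi> v"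
proof -
  have "\<exists>v. \<forall>\<psi>. \<Phi> \<psi> = blinfun_apply \<psi> v"
    using assms
  proof (induction F arbitrary: \<Phi>)
    case empty
    then show ?case by (intro exI[of _ 0]) (simp add: blinfun.zero_right)
  next
    case (insert w F)
    show ?case
    proof (cases "\<forall>\<psi> :: 'a \<Rightarrow>\<^sub>L real. (\<forall>v\<in>F. blinfun_apply \<psi> v = 0) \<longrightarrow> blinfun_apply \<psi> w = 0")
      case True
      show ?thesis
      proof (rule insert.IH)
        show "linear \<Phi>" by fact
        fix \<psi> :: "'a \<Rightarrow>\<^sub>L real" assume *: "\<And>v. v \<in> F \<Longrightarrow> \<psi> v = 0"
        have "\<psi> w = 0" using True * by simp
        then have "\<psi> v = 0" if "v \<in> insert w F" for v using that * by (cases "v = w") simp_all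
        then show "\<Phi> \<psi> = 0" by (rule insert.prems)
      qed
    next
      case False
      then obtain \<eta> :: "'a \<Rightarrow>\<^sub>L real" where \<eta>: "\<And>v. v \<in> F \<Longrightarrow> \<eta> v = 0" "\<eta> w \<noteq> 0" by blast
      define \<xi> where "\<xi> = (1 / \<eta> w) *\<^sub>R \<eta>"
      have \<xi>: "\<And>v. v \<in> F \<Longrightarrow> \<xi> v = 0" "\<xi> w = 1"
        using \<eta> by (auto simp: \<xi>_def blinfun.scaleR_left)
      interpret \<Phi>: linear \<Phi> by fact
      have "\<exists>v. \<forall>\<psi>. \<Phi> \<psi> - \<Phi> \<xi> * blinfun_apply \<psi> w = blinfun_apply \<psi> v"
      proof (rule insert.IH)
        show "linear (\<lambda>\<psi>. \<Phi> \<psi> - \<Phi> \<xi> * blinfun_apply \<psi> w)"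
          by (intro linearI)
            (auto simp: \<Phi>.add \<Phi>.scaleR blinfun.add_left blinfun.scaleR_left algebra_simps)
        fix \<psi> :: "'a \<Rightarrow>\<^sub>L real" assume "\<And>v. v \<in> F \<Longrightarrow> \<psi> v = 0"
        then have "\<Phi> (\<psi> - \<psi> w *\<^sub>R \<xi>) = 0"
          using \<xi> by (intro insert.prems) (auto simp: blinfun.diff_left blinfun.scaleR_left)
        then show "\<Phi> \<psi> - \<Phi> \<xi> * \<psi> w = 0" by (simp add: \<Phi>.diff \<Phi>.scaleR)
      qed
      then obtain v where v: "\<And>\<psi>. \<Phi> \<psi> - \<Phi> \<xi> * blinfun_apply \<psi> w = blinfun_apply \<psi> v" by blast
      have "\<Phi> \<psi> = blinfun_apply \<psi> (v + \<Phi> \<xi> *\<^sub>R w)" for \<psi>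
        using v[of \<psi>] by (simp add: blinfun.add_right blinfun.scaleR_right)
      then show ?thesis by blast
    qed
  qed
  then show ?thesis using that by blast
qed

text \<open>Separation of \<open>A\<close> from the dual ball of radius \<open>s\<close> by an element of the space rather than of
  its bidual. By compactness of the ball there are a finite \<open>F\<close> and an \<open>e > 0\<close> such that every \<open>a \<in> A\<close>
  differs by at least \<open>e\<close> at some point of \<open>F\<close> from every functional in the ball. Put
  \<open>D \<psi> = (s / e) (\<Sum>v\<in>F. \<bar>\<psi> v\<bar>)\<close> and let \<open>p\<close> be the infimal convolution of the norm with \<open>D\<close>. Then
  \<open>s \<le> p\<close> on \<open>A\<close>, and Mazur--Orlicz gives a linear \<open>\<Phi> \<le> p\<close> with \<open>s \<le> \<Phi>\<close> on \<open>A\<close>. From \<open>p \<le> D\<close> it follows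
  that \<open>\<Phi>\<close> is the evaluation at some \<open>v\<close>, and from \<open>p \<le> norm\<close> that \<open>\<parallel>v\<parallel> \<le> 1\<close>.\<close>
lemma weak_star_separate_from_ball:
  fixes A :: "('a::real_normed_vector \<Rightarrow>\<^sub>L real) set"
  assumes A: "closedin weak_star_topology A" "convex A" "A \<noteq> {}"
    and s: "0 < s" "\<And>a. a \<in> A \<Longrightarrow> s < norm a"
  obtains v where "norm v \<le> 1" "\<And>a. a \<in> A \<Longrightarrow> s \<le> blinfun_apply a v"
proof -
  obtain W where W: "open W" "- A = blinfun_apply -` W"
    using A(1) unfolding weak_star_topology_def closedin_def strong_operator_topology_def
    by (auto simp: openin_pullback_topology topspace_pullback_topology Compl_eq_Diff_UNIV)
  have A_iff: "a \<in> A \<longleftrightarrow> blinfun_apply a \<in> - W" for a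
    using W(2) by blast
  have "blinfun_apply ` cball 0 s \<inter> - W = {}"
    using A_iff s by (force simp: not_le[symmetric])
  then obtain F e where F: "finite F" "0 < e"
    and Fe: "\<And>k a. k \<in> blinfun_apply ` cball 0 s \<Longrightarrow> a \<in> - W \<Longrightarrow> \<exists>v\<in>F. e \<le> \<bar>a v - k v\<bar>"
    using compact_closed_uniform_box[OF Banach_Alaoglu, of "- W" s] W(1) by (metis closed_Compl)
  define D where "D = (\<lambda>\<psi> :: 'a \<Rightarrow>\<^sub>L real. (s / e) * (\<Sum>v\<in>F. \<bar>\<psi> v\<bar>))"
  have D0: "0 \<le> D \<psi>" for \<psi> using s F by (auto simp: D_def intro!: mult_nonneg_nonneg sum_nonneg)
  have D_add: "D (\<psi> + \<eta>) \<le> D \<psi> + D \<eta>" for \<psi> \<eta>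
    unfolding D_def distrib_left[symmetric] sum.distrib[symmetric] using s F
    by (intro mult_left_mono sum_mono) (auto simp: blinfun.add_left abs_triangle_ineq)
  have D_scale: "D (t *\<^sub>R \<psi>) = \<bar>t\<bar> * D \<psi>" for t \<psi>
    by (simp add: D_def blinfun.scaleR_left abs_mult sum_distrib_left mult.left_commute)
  define G where "G = (\<lambda>\<eta> \<psi>. norm \<eta> + D (\<psi> - \<eta>))"
  define p where "p = (\<lambda>\<psi>. INF \<eta>. G \<eta> \<psi>)"
  have bdd: "bdd_below (range (\<lambda>\<eta>. G \<eta> \<psi>))" for \<psi>
    using D0 by (intro bdd_belowI2[where m = 0]) (simp add: G_def)
  have p_le: "p \<psi> \<le> G \<eta> \<psi>" for \<psi> \<eta>
    unfolding p_def by (intro cINF_lower bdd) simp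
  have "sublinear p"
    unfolding p_def
  proof (rule sublinear_INF[OF _ bdd])
    show "\<exists>k\<in>UNIV. G k (\<psi> + \<theta>) \<le> G \<eta> \<psi> + G \<zeta> \<theta>" for \<eta> \<zeta> \<psi> \<theta>
      using norm_triangle_ineq[of \<eta> \<zeta>] D_add[of "\<psi> - \<eta>" "\<theta> - \<zeta>"]
      by (intro bexI[of _ "\<eta> + \<zeta>"]) (auto simp: G_def algebra_simps)
    show "\<exists>k\<in>UNIV. G k (t *\<^sub>R \<psi>) \<le> t * G \<eta> \<psi>" if "0 < t" for \<eta> \<psi> and t :: real
      using that D_scale[of t "\<psi> - \<eta>"]
      by (intro bexI[of _ "t *\<^sub>R \<eta>"]) (auto simp: G_def algebra_simps)
  qed simp
  moreover have "s \<le> p a" if "a \<in> A" for a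
    unfolding p_def
  proof (rule cINF_greatest)
    fix \<eta> :: "'a \<Rightarrow>\<^sub>L real"
    show "s \<le> G \<eta> a"
    proof (cases "norm \<eta> \<le> s")
      case True
      then obtain v where v: "v \<in> F" "e \<le> \<bar>a v - \<eta> v\<bar>"
        using Fe[of "blinfun_apply \<eta>" "blinfun_apply a"] A_iff[of a] \<open>a \<in> A\<close> by auto
      have "e \<le> (\<Sum>v\<in>F. \<bar>(a - \<eta>) v\<bar>)"
        using member_le_sum[OF v(1), of "\<lambda>v. \<bar>(a - \<eta>) v\<bar>"] F v(2) by (simp add: blinfun.diff_left)
      then have "s \<le> D (a - \<eta>)"
        using s F by (simp add: D_def field_simps)
      then show ?thesis by (simp add: G_def add_increasing)
    next
      case False
      then show ?thesis using D0[of "a - \<eta>"] by (simp add: G_def)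
    qed
  qed simp
  ultimately obtain \<Phi> where \<Phi>: "linear \<Phi>" "\<And>\<psi>. \<Phi> \<psi> \<le> p \<psi>" "\<And>a. a \<in> A \<Longrightarrow> s \<le> \<Phi> a"
    using Mazur_Orlicz[of p A s] A by blast
  have "\<Phi> \<psi> = 0" if "\<And>v. v \<in> F \<Longrightarrow> blinfun_apply \<psi> v = 0" for \<psi>
  proof -
    have "D \<psi> = 0" "D (- \<psi>) = 0"
      using that by (auto simp: D_def blinfun.minus_left)
    then have "\<Phi> \<psi> \<le> 0" "\<Phi> (- \<psi>) \<le> 0"
      using \<Phi>(2)[of \<psi>] \<Phi>(2)[of "- \<psi>"] p_le[of \<psi> 0] p_le[of "- \<psi>" 0] by (auto simp: G_def)
    then show ?thesis using linear_neg[OF \<Phi>(1), of \<psi>] by simp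
  qed
  then obtain v where v: "\<And>\<psi>. \<Phi> \<psi> = blinfun_apply \<psi> v"
    using functional_of_finitely_many_evaluations[OF F(1) \<Phi>(1)] by blast
  have "D 0 = 0" by (simp add: D_def)
  then have "\<psi> v \<le> norm \<psi>" for \<psi> :: "'a \<Rightarrow>\<^sub>L real"
    using \<Phi>(2)[of \<psi>] p_le[of \<psi> \<psi>] by (simp add: v G_def)
  then have "norm v \<le> 1" by (rule norm_le_if_dual_le)
  then show ?thesis using \<Phi>(3) v by (intro that[of v]) auto
qed

section \<open>Ekeland's variational principle\<close>

text \<open>The relation \<open>u \<in> R w\<close>, that is \<open>g u + \<gamma> dist u w \<le> g w\<close>, is a partial order on \<open>S\<close>, and \<open>w\<close> is to
  be a minimal element below \<open>z\<close>. Descend along a sequence \<open>a\<close> whose next term nearly minimizes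
  \<open>g\<close> over \<open>R (a n)\<close>. The diameters of the sets \<open>R (a n)\<close> then tend to zero, so \<open>a\<close> converges, and its
  limit is the only point below itself.\<close>

lemma Ekeland_variational_principle:
  fixes g :: "'a::metric_space \<Rightarrow> real"
  assumes S: "complete S" and g: "continuous_on S g" "\<And>u. u \<in> S \<Longrightarrow> 0 \<le> g u"
    and "z \<in> S" "0 < \<gamma>"
  obtains w where "w \<in> S" "g w + \<gamma> * dist w z \<le> g z"
    "\<And>u. u \<in> S \<Longrightarrow> g u + \<gamma> * dist u w \<le> g w \<Longrightarrow> u = w"
proof -
  define R where "R = (\<lambda>w. {u \<in> S. g u + \<gamma> * dist u w \<le> g w})"
  have R_refl: "w \<in> R w" if "w \<in> S" for w using that by (simp add: R_def)
  have R_trans: "u \<in> R w" if "u \<in> R v" "v \<in> R w" for u v w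
  proof -
    have "\<gamma> * dist u w \<le> \<gamma> * (dist u v + dist v w)"
      using \<open>0 < \<gamma>\<close> by (intro mult_left_mono dist_triangle) auto
    then show ?thesis using that by (simp add: R_def distrib_left)
  qed
  have step: "\<exists>v. v \<in> R w \<and> (\<forall>u\<in>R w. g v \<le> g u + (1/2) ^ n)" if "w \<in> S" for w and n :: nat
  proof -
    have bdd: "bdd_below (g ` R w)" using g(2) by (intro bdd_belowI2[where m = 0]) (auto simp: R_def)
    have "\<exists>v\<in>R w. g v < (INF u\<in>R w. g u) + (1/2) ^ n"
      using R_refl[OF that] by (subst cINF_less_iff[symmetric, OF _ bdd]) auto
    then obtain v where v: "v \<in> R w" "g v < (INF u\<in>R w. g u) + (1/2) ^ n" by blast
    moreover have "(INF u\<in>R w. g u) \<le> g u" if "u \<in> R w" for u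
      using bdd that by (rule cINF_lower)
    ultimately show ?thesis by (intro exI[of _ v]) force
  qed
  obtain a where a0: "a 0 = z" and aS: "\<And>n. a n \<in> S"
    and a: "\<And>n. a (Suc n) \<in> R (a n)" "\<And>n u. u \<in> R (a n) \<Longrightarrow> g (a (Suc n)) \<le> g u + (1/2) ^ n"
  proof -
    obtain F where F: "\<And>w n. w \<in> S \<Longrightarrow> F w n \<in> R w \<and> (\<forall>u\<in>R w. g (F w n) \<le> g u + (1/2) ^ n)"
      using step by metis
    define a where "a = rec_nat z (\<lambda>n w. F w n)"
    have a_simps: "a 0 = z" "\<And>n. a (Suc n) = F (a n) n" by (auto simp: a_def)
    have aS: "a n \<in> S" for n
    proof (induction n)
      case (Suc n)
      then show ?case using F[of "a n" n] by (simp add: a_simps R_def)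
    qed (simp add: a_simps \<open>z \<in> S\<close>)
    show ?thesis
      using F[OF aS] by (intro that[of a] aS) (simp_all add: a_simps)
  qed
  have a_mono: "a m \<in> R (a n)" if "n \<le> m" for m n
    using that
  proof (induction m rule: dec_induct)
    case base
    show ?case using R_refl aS .
  next
    case (step m)
    then show ?case using R_trans a(1) by blast
  qed
  \<comment> \<open>A point below \<open>a (Suc n)\<close> is also below \<open>a n\<close>, so \<open>g\<close> can drop by at most \<open>(1/2) ^ n\<close> there.\<close>
  have small: "\<gamma> * dist u (a (Suc n)) \<le> (1/2) ^ n" if "u \<in> R (a (Suc n))" for u n
  proof -
    have "g (a (Suc n)) \<le> g u + (1/2) ^ n"
      using R_trans[OF that a(1)] by (rule a(2))
    then show ?thesis using that by (simp add: R_def)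
  qed
  have lim0: "(\<lambda>n. (1/2) ^ n / \<gamma>) \<longlonglongrightarrow> 0"
    using tendsto_divide_zero[OF LIMSEQ_realpow_zero[of "1/2"]] by simp
  have near: "dist u (a (Suc n)) \<le> (1/2) ^ n / \<gamma>" if "u \<in> R (a (Suc n))" for u n
    using small[OF that] \<open>0 < \<gamma>\<close> by (simp add: field_simps)
  have "Cauchy a"
  proof (rule metric_CauchyI)
    fix e :: real assume "0 < e"
    then obtain n where n: "(1/2) ^ n / \<gamma> < e / 2"
      using order_tendstoD(2)[OF lim0, of "e / 2"] by (auto simp: eventually_sequentially)
    show "\<exists>M. \<forall>m\<ge>M. \<forall>k\<ge>M. dist (a m) (a k) < e"
    proof (intro exI[of _ "Suc n"] allI impI)
      fix m k assume "Suc n \<le> m" "Suc n \<le> k"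
      then have "dist (a m) (a (Suc n)) < e / 2" "dist (a k) (a (Suc n)) < e / 2"
        using near[OF a_mono] n by (meson le_less_trans)+
      then show "dist (a m) (a k) < e" by (rule dist_triangle_half_l)
    qed
  qed
  then obtain w where w: "w \<in> S" "a \<longlonglongrightarrow> w"
    using S aS unfolding complete_def by blast
  have ga: "(\<lambda>m. g (a m)) \<longlonglongrightarrow> g w"
    using continuous_on_tendsto_compose[OF g(1) w(2,1)] aS by simp
  have wR: "w \<in> R (a n)" for n
  proof -
    have "(\<lambda>m. g (a m) + \<gamma> * dist (a m) (a n)) \<longlonglongrightarrow> g w + \<gamma> * dist w (a n)"
      using ga w(2) by (intro tendsto_intros)
    moreover have "\<forall>m\<ge>n. g (a m) + \<gamma> * dist (a m) (a n) \<le> g (a n)"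
      using a_mono by (simp add: R_def)
    ultimately have "g w + \<gamma> * dist w (a n) \<le> g (a n)"
      by (intro LIMSEQ_le_const2) blast+
    with w show ?thesis by (simp add: R_def)
  qed
  show ?thesis
  proof (rule that)
    show "w \<in> S" by fact
    show "g w + \<gamma> * dist w z \<le> g z" using wR[of 0] by (simp add: R_def a0)
    fix u assume "u \<in> S" "g u + \<gamma> * dist u w \<le> g w"
    then have "u \<in> R w" by (simp add: R_def)
    then have "\<And>n. dist u (a (Suc n)) \<le> (1/2) ^ n / \<gamma>"
      using R_trans wR near by blast
    moreover have "(\<lambda>n. dist u (a (Suc n))) \<longlonglongrightarrow> dist u w"
      using LIMSEQ_Suc[OF w(2)] by (intro tendsto_intros)
    ultimately have "dist u w \<le> 0"
      by (intro LIMSEQ_le[OF _ lim0]) blast+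
    then show "u = w" by simp
  qed
qed

section \<open>Expansion of distances by the mean value inequality\<close>

lemma upper_dini_less_eventually:
  assumes "upper_dini \<phi> x v < ereal m"
  shows "\<forall>\<^sub>F t in at_right 0. \<phi> (x + t *\<^sub>R v) < \<phi> x + m * t"
proof -
  have "\<forall>\<^sub>F t in at_right 0. ereal ((\<phi> (x + t *\<^sub>R v) - \<phi> x) / t) < ereal m"
    using assms unfolding upper_dini_def by (rule Limsup_lessD)
  with eventually_at_right_less[of "0::real"] show ?thesis
    by eventually_elim (simp add: field_simps)
qed

text \<open>For every \<open>e > 0\<close>, the set of parameters \<open>t \<in> [0, 1]\<close> at which the increment from \<open>u\<close> is at most
  \<open>(m + e) t\<close> is closed, and the derivative bound shows that its supremum cannot be smaller than \<open>1\<close>.\<close>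
lemma increment_le_of_upper_dini_le:
  fixes \<phi> :: "'a::real_normed_vector \<Rightarrow> real"
  assumes cont: "continuous_on (closed_segment u (u + h)) \<phi>"
    and dini: "\<And>z. z \<in> closed_segment u (u + h) \<Longrightarrow> upper_dini \<phi> z h \<le> ereal m"
  shows "\<phi> (u + h) - \<phi> u \<le> m"
proof (rule field_le_epsilon)
  fix e :: real assume "0 < e"
  define \<theta> where "\<theta> = (\<lambda>t. \<phi> (u + t *\<^sub>R h))"
  have seg: "u + t *\<^sub>R h \<in> closed_segment u (u + h)" if "t \<in> {0..1}" for t
    using that unfolding closed_segment_def
    by (auto intro!: exI[of _ t] simp: algebra_simps)
  have "continuous_on {0..1} \<theta>"
    unfolding \<theta>_def
    by (rule continuous_on_compose2[OF cont]) (use seg in \<open>auto intro!: continuous_intros\<close>)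
  define E where "E = {t \<in> {0..1}. \<theta> t \<le> \<theta> 0 + (m + e) * t}"
  have "closed E"
    unfolding E_def
    by (intro continuous_on_closed_Collect_le continuous_intros \<open>continuous_on {0..1} \<theta>\<close>)
  moreover have "E \<subseteq> {0..1}" by (auto simp: E_def)
  moreover have "0 \<in> E" by (simp add: E_def)
  ultimately have "Sup E \<in> E"
    by (intro closed_contains_Sup) (auto intro: bdd_above_mono)
  define s where "s = Sup E"
  have s: "s \<in> {0..1}" "\<theta> s \<le> \<theta> 0 + (m + e) * s"
    using \<open>Sup E \<in> E\<close> by (auto simp: s_def E_def)
  have "s = 1"
  proof (rule ccontr)
    assume "s \<noteq> 1"
    then have "s < 1" using s by simp
    have "upper_dini \<phi> (u + s *\<^sub>R h) h < ereal (m + e)"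
      using dini[OF seg[OF s(1)]] \<open>0 < e\<close> by (simp add: le_less_trans)
    then have "\<forall>\<^sub>F t in at_right 0. \<theta> (s + t) < \<theta> s + (m + e) * t"
      using upper_dini_less_eventually by (fastforce simp: \<theta>_def scaleR_add_left add.assoc)
    moreover have "\<forall>\<^sub>F t in at_right 0. t < 1 - s"
      using \<open>s < 1\<close> by (intro eventually_at_rightI[of 0 "1 - s"]) auto
    moreover have "\<forall>\<^sub>F t in at_right (0::real). 0 < t"
      by (rule eventually_at_right_less)
    ultimately have "\<forall>\<^sub>F t in at_right 0. 0 < t \<and> s + t \<in> E"
    proof eventually_elim
      case (elim t)
      then show ?case using s by (simp add: E_def algebra_simps)
    qed
    then obtain t where "0 < t" "s + t \<in> E"
      using eventually_happens'[OF trivial_limit_at_right_real] by blast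
    then have "s + t \<le> s"
      unfolding s_def by (intro cSup_upper) (use \<open>E \<subseteq> {0..1}\<close> in \<open>auto intro: bdd_above_mono\<close>)
    with \<open>0 < t\<close> show False by simp
  qed
  with s show "\<phi> (u + h) - \<phi> u \<le> m + e" by (simp add: \<theta>_def)
qed

lemma conorm_le_iff: "ereal s \<le> conorm T \<longleftrightarrow> (\<forall>v. s * norm v \<le> norm (T v))"
proof
  assume le: "ereal s \<le> conorm T"
  show "\<forall>v. s * norm v \<le> norm (T v)"
  proof
    fix v
    show "s * norm v \<le> norm (T v)"
    proof (cases "v = 0")
      case False
      have "conorm T \<le> ereal (norm (T (v /\<^sub>R norm v)))"
        unfolding conorm_def using False by (intro INF_lower) simp
      with le have "s \<le> norm (T (v /\<^sub>R norm v))" using order_trans by fastforce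
      then show ?thesis using False by (simp add: blinfun.scaleR_right field_simps)
    qed (simp add: blinfun.zero_right)
  qed
next
  assume le: "\<forall>v. s * norm v \<le> norm (T v)"
  show "ereal s \<le> conorm T"
    unfolding conorm_def
  proof (rule INF_greatest)
    fix v :: 'a assume "v \<in> {v. norm v = 1}"
    with le[rule_format, of v] show "ereal s \<le> ereal (norm (T v))" by simp
  qed
qed

text \<open>For \<open>h = w - u\<close> the vectors \<open>T h\<close>, with \<open>T\<close> in the convex hull of all values of \<open>Jf\<close>, form a convex
  set outside the open ball of radius \<open>s \<parallel>h\<parallel>\<close>. Some \<open>\<psi>\<close> in the dual unit ball is therefore at least
  \<open>s \<parallel>h\<parallel>\<close> on all of them. The pseudo-Jacobian inequality for \<open>- \<psi>\<close> bounds the derivative of \<open>- \<psi> \<circ> f\<close> in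
  direction \<open>h\<close> by \<open>- s \<parallel>h\<parallel>\<close> along the segment, and integration yields
  \<open>s \<parallel>h\<parallel> \<le> \<psi> (f w - f u) \<le> \<parallel>f w - f u\<parallel>\<close>.\<close>
lemma pseudo_Jacobian_expansion:
  fixes f :: "'a::real_normed_vector \<Rightarrow> 'b::real_normed_vector"
  assumes S: "convex S" and f: "continuous_on S f" and J: "pseudo_Jacobian_mapping S f Jf"
    and bound: "\<And>T v. T \<in> convex hull (\<Union>z\<in>S. Jf z) \<Longrightarrow> s * norm v \<le> norm (T v)"
    and uw: "u \<in> S" "w \<in> S"
  shows "s * norm (w - u) \<le> norm (f w - f u)"
proof -
  define h where "h = w - u"
  define H where "H = convex hull (\<Union>z\<in>S. Jf z)"
  have "Jf u \<noteq> {}" using J uw by (auto simp: pseudo_Jacobian_mapping_def pseudo_Jacobian_def)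
  then have "H \<noteq> {}" using uw by (auto simp: H_def)
  have "convex ((\<lambda>T. blinfun_apply T h) ` H)"
    unfolding H_def by (intro convex_linear_image convex_convex_hull bounded_linear.linear
        blinfun.bounded_linear_left)
  moreover have "s * norm h \<le> norm c" if "c \<in> (\<lambda>T. blinfun_apply T h) ` H" for c
    using that bound by (auto simp: H_def)
  ultimately obtain \<psi> :: "'b \<Rightarrow>\<^sub>L real" where "norm \<psi> \<le> 1"
      "\<And>c. c \<in> (\<lambda>T. blinfun_apply T h) ` H \<Longrightarrow> s * norm h \<le> \<psi> c"
    using separate_from_ball[of "(\<lambda>T. blinfun_apply T h) ` H" "s * norm h"] \<open>H \<noteq> {}\<close> by blast
  then have \<psi>: "norm \<psi> \<le> 1" "\<And>T. T \<in> H \<Longrightarrow> s * norm h \<le> \<psi> (T h)" by blast+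
  have seg: "closed_segment u (u + h) \<subseteq> S"
    using closed_segment_subset[OF _ _ S] uw by (simp add: h_def)
  have "(blinfun_apply (- \<psi>) \<circ> f) (u + h) - (blinfun_apply (- \<psi>) \<circ> f) u \<le> - (s * norm h)"
  proof (rule increment_le_of_upper_dini_le)
    show "continuous_on (closed_segment u (u + h)) (blinfun_apply (- \<psi>) \<circ> f)"
      using continuous_on_subset[OF f seg] unfolding comp_def by (intro continuous_intros)
    fix z assume "z \<in> closed_segment u (u + h)"
    then have "z \<in> S" using seg by blast
    then have "upper_dini (blinfun_apply (- \<psi>) \<circ> f) z h \<le> (SUP T\<in>Jf z. ereal ((- \<psi>) (blinfun_apply T h)))"
      using J by (simp add: pseudo_Jacobian_mapping_def pseudo_Jacobian_def)
    also have "\<dots> \<le> ereal (- (s * norm h))"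
    proof (rule SUP_least)
      fix T assume "T \<in> Jf z"
      then have "T \<in> H" unfolding H_def using \<open>z \<in> S\<close> by (intro hull_inc) blast
      then show "ereal ((- \<psi>) (T h)) \<le> ereal (- (s * norm h))"
        using \<psi>(2) by (simp add: blinfun.minus_left)
    qed
    finally show "upper_dini (blinfun_apply (- \<psi>) \<circ> f) z h \<le> ereal (- (s * norm h))" .
  qed
  then have "s * norm h \<le> \<psi> (f w - f u)"
    by (simp add: blinfun.minus_left blinfun.diff_right h_def)
  also have "\<dots> \<le> norm \<psi> * norm (f w - f u)"
    using norm_blinfun[of \<psi> "f w - f u"] by simp
  also have "\<dots> \<le> norm (f w - f u)"
    using \<psi>(1) by (simp add: mult_left_le_one_le)
  finally show ?thesis by (simp add: h_def)
qed

section \<open>Openness at a linear rate\<close>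

text \<open>Let \<open>q = f w - y\<close>. The subgradient inequality at the point \<open>y\<close> gives \<open>\<parallel>q\<parallel> \<le> \<psi> q\<close>. For \<open>R\<close> in the
  convex hull itself, solve \<open>R v = q\<close>; then \<open>s \<parallel>v\<parallel> \<le> \<parallel>q\<parallel> \<le> (\<psi> \<circ> R) v\<close>, so that \<open>\<parallel>\<psi> \<circ> R\<parallel> \<ge> s\<close>. An
  element \<open>T\<close> of the closure is approximated by such \<open>R\<close>, which costs only an arbitrarily small error.\<close>

lemma chain_set_norm_ge:
  fixes f :: "'a::real_normed_vector \<Rightarrow> 'b::real_normed_vector"
  assumes "y \<noteq> f w"
    and T: "\<And>T. T \<in> convex hull Jf w \<Longrightarrow> surj (blinfun_apply T)"
      "\<And>T v. T \<in> convex hull Jf w \<Longrightarrow> s * norm v \<le> norm (T v)"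
    and a: "a \<in> chain_set f Jf w y"
  shows "s \<le> norm a"
proof -
  obtain \<psi> :: "'b \<Rightarrow>\<^sub>L real" and T where a_eq: "a = \<psi> o\<^sub>L T"
    and \<psi>: "\<psi> \<in> Clarke_subdifferential (\<lambda>v. norm (v - y)) (f w)"
    and TJ: "T \<in> closure (convex hull Jf w)"
    using a by (auto simp: chain_set_def)
  define q where "q = f w - y"
  have "q \<noteq> 0" using assms(1) by (simp add: q_def)
  have "norm q + \<psi> (y - f w) \<le> 0"
    using \<psi> unfolding Clarke_subdifferential_norm_eq q_def mem_Collect_eq
    by (metis diff_self norm_zero)
  then have q: "norm q \<le> \<psi> q"
    by (simp add: q_def blinfun.diff_right)
  show ?thesis
  proof (rule field_le_epsilon)
    fix e :: real assume "0 < e"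
    \<comment> \<open>Chosen so that \<open>norm \<psi> * d \<le> e\<close>; the summand \<open>1\<close> prevents division by zero.\<close>
    define d where "d = e / (norm \<psi> + 1)"
    have "0 < norm \<psi> + 1" by (simp add: add_nonneg_pos)
    then have "0 < d" using \<open>0 < e\<close> by (simp add: d_def)
    then obtain R where R: "R \<in> convex hull Jf w" "dist R T < d"
      using TJ closure_approachable by blast
    obtain v where v: "R v = q" using T(1)[OF R(1)] by (metis surjD)
    have "v \<noteq> 0" using v \<open>q \<noteq> 0\<close> by (auto simp: blinfun.zero_right)
    have "s * norm v \<le> \<psi> (R v)" using T(2)[OF R(1), of v] q v by simp
    also have "\<dots> = a v + \<psi> ((R - T) v)"
      by (simp add: a_eq blinfun.diff_left blinfun.diff_right)
    also have "a v \<le> norm a * norm v"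
      using norm_blinfun[of a v] by simp
    also have "\<psi> ((R - T) v) \<le> norm \<psi> * norm ((R - T) v)"
      using norm_blinfun[of \<psi> "(R - T) v"] by simp
    also have "\<dots> \<le> norm \<psi> * (d * norm v)"
      using norm_blinfun[of "R - T" v] R(2)
      by (intro mult_left_mono order_trans[OF norm_blinfun] mult_right_mono) (auto simp: dist_norm)
    also have "\<dots> \<le> e * norm v"
    proof -
      have "norm \<psi> * d \<le> e"
        using \<open>0 < e\<close> \<open>0 < norm \<psi> + 1\<close> by (simp add: d_def field_simps)
      then show ?thesis by (metis mult.assoc mult_right_mono norm_ge_zero)
    qed
    finally have "s * norm v \<le> (norm a + e) * norm v" by (simp add: distrib_right)
    then show "s \<le> norm a + e" using \<open>v \<noteq> 0\<close> by simp
  qed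
qed

text \<open>If \<open>v\<close> separates \<open>A\<close> from the dual ball of radius \<open>s\<close>, then every element of \<open>A\<close> is at most \<open>- s\<close>
  at \<open>- v\<close>, so \<open>g\<close> decreases at rate \<open>s\<close> in that direction.\<close>
lemma descent_direction:
  fixes g :: "'a::real_normed_vector \<Rightarrow> real"
  assumes A: "pseudo_Jacobian g w A" "closedin weak_star_topology A" "convex A"
    and s: "0 < s" "\<And>a. a \<in> A \<Longrightarrow> s < norm a"
  obtains v where "norm v \<le> 1" "upper_dini g w v \<le> ereal (- s)"
proof -
  have "A \<noteq> {}" using A(1) by (simp add: pseudo_Jacobian_def)
  then obtain v where v: "norm v \<le> 1" "\<And>a. a \<in> A \<Longrightarrow> s \<le> blinfun_apply a v"
    using weak_star_separate_from_ball[OF A(2,3) _ s] by blast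
  have "upper_dini (blinfun_apply id_blinfun \<circ> g) w (- v)
      \<le> (SUP a\<in>A. ereal (blinfun_apply id_blinfun (blinfun_apply a (- v))))"
    using A(1) unfolding pseudo_Jacobian_def by blast
  also have "\<dots> \<le> ereal (- s)"
    using v(2) by (intro SUP_least) (simp add: blinfun.minus_right)
  also have "blinfun_apply id_blinfun \<circ> g = g" by (simp add: fun_eq_iff)
  finally show ?thesis using v(1) by (intro that[of "- v"]) auto
qed

text \<open>An Ekeland point \<open>w\<close> for the slope \<open>\<alpha>\<close> satisfies \<open>\<alpha> dist w z \<le> g z < \<alpha> \<rho>\<close>, hence is interior. No
  direction of descent at a rate above \<open>\<alpha>\<close> can exist at \<open>w\<close>, so \<open>g\<close> vanishes there.\<close>
lemma zero_of_uniform_descent: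
  fixes g :: "'a::banach \<Rightarrow> real"
  assumes g: "continuous_on (cball z \<rho>) g" "\<And>u. u \<in> cball z \<rho> \<Longrightarrow> 0 \<le> g u"
    and "0 < \<rho>" and \<alpha>: "0 < \<alpha>" "g z < \<alpha> * \<rho>"
    and descent: "\<And>w. w \<in> ball z \<rho> \<Longrightarrow> g w \<noteq> 0 \<Longrightarrow>
      \<exists>v. norm v \<le> 1 \<and> upper_dini g w v < ereal (- \<alpha>)"
  shows "\<exists>w\<in>ball z \<rho>. g w = 0"
proof -
  have "complete (cball z \<rho>)" by (simp add: complete_eq_closed)
  then obtain w where w: "w \<in> cball z \<rho>" "g w + \<alpha> * dist w z \<le> g z"
    and min: "\<And>u. u \<in> cball z \<rho> \<Longrightarrow> g u + \<alpha> * dist u w \<le> g w \<Longrightarrow> u = w"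
    using Ekeland_variational_principle[OF _ g, of z \<alpha>] \<open>0 < \<rho>\<close> \<alpha> by auto
  have "\<alpha> * dist w z < \<alpha> * \<rho>" using w g(2)[of w] \<alpha>(2) by linarith
  then have w_ball: "w \<in> ball z \<rho>" using \<alpha>(1) by (simp add: dist_commute)
  have "g w = 0"
  proof (rule ccontr)
    assume "g w \<noteq> 0"
    then obtain v where v: "norm v \<le> 1" "upper_dini g w v < ereal (- \<alpha>)"
      using descent[OF w_ball] by blast
    have "((\<lambda>t. w + t *\<^sub>R v) \<longlongrightarrow> w + 0 *\<^sub>R v) (at_right 0)"
      by (intro tendsto_intros)
    then have "\<forall>\<^sub>F t in at_right 0. w + t *\<^sub>R v \<in> ball z \<rho>"
      using w_ball by (intro topological_tendstoD) auto
    with upper_dini_less_eventually[OF v(2)] eventually_at_right_less[of "0::real"]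
    have "\<forall>\<^sub>F t in at_right 0. 0 < t \<and> w + t *\<^sub>R v \<in> ball z \<rho> \<and> g (w + t *\<^sub>R v) < g w - \<alpha> * t"
      by eventually_elim auto
    then obtain t where t: "0 < t" "w + t *\<^sub>R v \<in> ball z \<rho>" "g (w + t *\<^sub>R v) < g w - \<alpha> * t"
      using eventually_happens'[OF trivial_limit_at_right_real] by blast
    have "\<alpha> * (t * norm v) \<le> \<alpha> * t"
      using t(1) v(1) \<alpha>(1) by (simp add: mult_left_le)
    then have "g (w + t *\<^sub>R v) + \<alpha> * dist (w + t *\<^sub>R v) w \<le> g w"
      using t by (simp add: dist_norm)
    then have "w + t *\<^sub>R v = w" using t(2) by (intro min) auto
    with t(3) have "\<alpha> * t < 0" by simp
    with t(1) \<alpha>(1) show False by (simp add: mult_less_0_iff)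
  qed
  with w_ball show ?thesis by blast
qed

text \<open>Surjectivity onto the ball around \<open>f z\<close>: solving \<open>f w = y\<close> means finding a zero of
  \<open>g = \<parallel>f - y\<parallel>\<close>. Where \<open>g\<close> is nonzero the chain rule condition makes the set of composites
  \<open>\<psi> \<circ> T\<close> a weak-* closed convex pseudo-Jacobian of \<open>g\<close>, and its elements have norm at least \<open>\<beta>\<close>. An
  intermediate \<open>s\<close> between \<open>\<alpha>\<close> and \<open>\<beta>\<close> supplies the strict inequalities needed on both sides.\<close>
lemma linear_openness:
  fixes f :: "'a::banach \<Rightarrow> 'b::banach"
  assumes f: "continuous_on (cball z \<rho>) f" and chain: "chain_rule_condition (ball z \<rho>) f Jf"
    and "0 < \<rho>" and \<alpha>: "0 < \<alpha>" "\<alpha> < \<beta>"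
    and surj: "\<And>w T. w \<in> ball z \<rho> \<Longrightarrow> T \<in> convex hull Jf w \<Longrightarrow> surj (blinfun_apply T)"
    and below: "\<And>w T v. w \<in> ball z \<rho> \<Longrightarrow> T \<in> convex hull Jf w \<Longrightarrow>
      \<beta> * norm v \<le> norm (blinfun_apply T v)"
  shows "ball (f z) (\<alpha> * \<rho>) \<subseteq> f ` ball z \<rho>"
proof
  fix y assume y: "y \<in> ball (f z) (\<alpha> * \<rho>)"
  define g where "g = (\<lambda>v. norm (v - y)) \<circ> f"
  obtain s where s: "\<alpha> < s" "s < \<beta>" using dense[OF \<alpha>(2)] by blast
  have "\<exists>w\<in>ball z \<rho>. g w = 0"
  proof (rule zero_of_uniform_descent)
    show "continuous_on (cball z \<rho>) g"
      unfolding g_def comp_def using f by (intro continuous_intros)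
    show "g z < \<alpha> * \<rho>" using y by (simp add: g_def dist_norm)
    fix w assume w: "w \<in> ball z \<rho>" "g w \<noteq> 0"
    then have "y \<noteq> f w" by (auto simp: g_def)
    with chain w(1) have A: "closedin weak_star_topology (chain_set f Jf w y)"
        "convex (chain_set f Jf w y)" "pseudo_Jacobian g w (chain_set f Jf w y)"
      by (auto simp: chain_rule_condition_def g_def)
    have "s < norm a" if "a \<in> chain_set f Jf w y" for a
      using chain_set_norm_ge[OF \<open>y \<noteq> f w\<close> surj[OF w(1)] below[OF w(1)] that] \<alpha> s by force
    then obtain v where "norm v \<le> 1" "upper_dini g w v \<le> ereal (- s)"
      using descent_direction[OF A(3,1,2), of s] \<alpha>(1) s(1) by (metis less_trans)
    then show "\<exists>v. norm v \<le> 1 \<and> upper_dini g w v < ereal (- \<alpha>)"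
      using s(1) by (intro exI[of _ v]) (auto intro: le_less_trans)
  qed (use \<open>0 < \<rho>\<close> \<alpha> in \<open>auto simp: g_def\<close>)
  then show "y \<in> f ` ball z \<rho>" by (auto simp: g_def)
qed

section \<open>The inverse mapping theorem\<close>

text \<open>Both parts of regularity hold on one common ball, since shrinking the ball shrinks the
  convex hull. The constant \<open>\<beta>\<close> stays strictly above \<open>\<alpha>\<close>, which is the slack that the descent
  argument consumes.\<close>

lemma regular_at_uniform_conorm:
  assumes "regular_at U Jf x" "ereal \<alpha> < regularity_index U Jf x"
  obtains r \<beta> where "0 < r" "ball x r \<subseteq> U" "\<alpha> < \<beta>"
    "\<And>T. T \<in> convex hull (\<Union>z\<in>ball x r. Jf z) \<Longrightarrow> surj (blinfun_apply T)"
    "\<And>T v. T \<in> convex hull (\<Union>z\<in>ball x r. Jf z) \<Longrightarrow> \<beta> * norm v \<le> norm (blinfun_apply T v)"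
proof -
  obtain r\<^sub>1 where r1: "0 < r\<^sub>1" "ball x r\<^sub>1 \<subseteq> U"
    "\<And>T. T \<in> convex hull (\<Union>z\<in>ball x r\<^sub>1. Jf z) \<Longrightarrow> surj (blinfun_apply T)"
    using assms(1) unfolding regular_at_def Banach_isomorphism_def bij_def by blast
  obtain r\<^sub>2 where r2: "0 < r\<^sub>2" "ball x r\<^sub>2 \<subseteq> U"
    "ereal \<alpha> < (INF T\<in>convex hull (\<Union>z\<in>ball x r\<^sub>2. Jf z). conorm T)"
    using assms(2) unfolding regularity_index_def less_SUP_iff by blast
  obtain \<beta> where \<beta>: "\<alpha> < \<beta>" "ereal \<beta> < (INF T\<in>convex hull (\<Union>z\<in>ball x r\<^sub>2. Jf z). conorm T)"
    using ereal_dense2[OF r2(3)] by auto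
  have hull: "convex hull (\<Union>z\<in>ball x (min r\<^sub>1 r\<^sub>2). Jf z) \<subseteq> convex hull (\<Union>z\<in>ball x r. Jf z)"
    if "r \<in> {r\<^sub>1, r\<^sub>2}" for r
    using that by (intro hull_mono UN_mono) auto
  show ?thesis
  proof (rule that[of "min r\<^sub>1 r\<^sub>2" \<beta>])
    show "0 < min r\<^sub>1 r\<^sub>2" "ball x (min r\<^sub>1 r\<^sub>2) \<subseteq> U" using r1 r2 by auto
    fix T assume T: "T \<in> convex hull (\<Union>z\<in>ball x (min r\<^sub>1 r\<^sub>2). Jf z)"
    show "surj (blinfun_apply T)" using hull T r1(3) by blast
    have "T \<in> convex hull (\<Union>z\<in>ball x r\<^sub>2. Jf z)" using hull T by blast
    then have "ereal \<beta> \<le> conorm T"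
      using \<beta>(2) by (meson INF_lower less_imp_le order_trans)
    then show "\<beta> * norm v \<le> norm (T v)" for v
      by (simp add: conorm_le_iff)
  qed (rule \<beta>)
qed

theorem theorem3p5:
  fixes U :: "'a::banach set" and f :: "'a \<Rightarrow> 'b::banach"
    and Jf :: "'a \<Rightarrow> ('a \<Rightarrow>\<^sub>L 'b) set" and x :: 'a
  assumes "open U"
    and "continuous_on U f"
    and "pseudo_Jacobian_mapping U f Jf"
    and "chain_rule_condition U f Jf"
    and "x \<in> U"
    and "regular_at U Jf x"
  shows "\<forall>\<alpha>::real. 0 < \<alpha> \<and> ereal \<alpha> < regularity_index U Jf x \<longrightarrow>
    (\<exists>r>0. ball x r \<subseteq> U \<and>
       open (f ` ball x r) \<and>
       homeomorphism (ball x r) (f ` ball x r) f (inv_into (ball x r) f) \<and>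
       (inverse \<alpha>)-lipschitz_on (f ` ball x r) (inv_into (ball x r) f))"
proof (intro allI impI)
  fix \<alpha> :: real assume "0 < \<alpha> \<and> ereal \<alpha> < regularity_index U Jf x"
  then have "0 < \<alpha>" and index: "ereal \<alpha> < regularity_index U Jf x" by auto
  obtain r \<beta> where r: "0 < r" "ball x r \<subseteq> U" and "\<alpha> < \<beta>"
    and surj: "\<And>T. T \<in> convex hull (\<Union>z\<in>ball x r. Jf z) \<Longrightarrow> surj (blinfun_apply T)"
    and below: "\<And>T v. T \<in> convex hull (\<Union>z\<in>ball x r. Jf z) \<Longrightarrow>
      \<beta> * norm v \<le> norm (blinfun_apply T v)"
    by (rule regular_at_uniform_conorm[OF assms(6) index]) blast
  let ?B = "ball x r" and ?h = "inv_into (ball x r) f"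
  have cont: "continuous_on ?B f" using assms(2) r(2) by (rule continuous_on_subset)
  have expand: "\<alpha> * dist u w \<le> dist (f u) (f w)" if "u \<in> ?B" "w \<in> ?B" for u w
  proof -
    have "pseudo_Jacobian_mapping ?B f Jf"
      using assms(3) r(2) by (auto simp: pseudo_Jacobian_mapping_def)
    then have "\<beta> * norm (u - w) \<le> norm (f u - f w)"
      using cont that below by (intro pseudo_Jacobian_expansion[of ?B f Jf]) auto
    moreover have "\<alpha> * norm (u - w) \<le> \<beta> * norm (u - w)"
      using \<open>\<alpha> < \<beta>\<close> by (intro mult_right_mono) auto
    ultimately show ?thesis by (simp add: dist_norm)
  qed
  have inj: "inj_on f ?B"
  proof (rule inj_onI)
    fix u w assume "u \<in> ?B" "w \<in> ?B" "f u = f w"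
    with expand[of u w] \<open>0 < \<alpha>\<close> show "u = w" by (simp add: mult_le_0_iff)
  qed
  have lip: "(inverse \<alpha>)-lipschitz_on (f ` ?B) ?h"
  proof (rule lipschitz_onI)
    fix p q assume "p \<in> f ` ?B" "q \<in> f ` ?B"
    then show "dist (?h p) (?h q) \<le> inverse \<alpha> * dist p q"
      using expand inj \<open>0 < \<alpha>\<close> by (auto simp: field_simps)
  qed (use \<open>0 < \<alpha>\<close> in simp)
  have "open (f ` ?B)"
    unfolding open_contains_ball
  proof
    fix p assume "p \<in> f ` ?B"
    then obtain z where z: "z \<in> ?B" "p = f z" by blast
    obtain \<rho> where \<rho>: "0 < \<rho>" "cball z \<rho> \<subseteq> ?B"
      using open_contains_cball[of ?B] z(1) open_ball by blast
    have sub: "ball z \<rho> \<subseteq> ?B" using \<rho>(2) ball_subset_cball by blast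
    have "convex hull Jf w \<subseteq> convex hull (\<Union>z\<in>?B. Jf z)" if "w \<in> ball z \<rho>" for w
      using sub that by (intro hull_mono) blast
    moreover have "chain_rule_condition (ball z \<rho>) f Jf"
      using assms(4) sub r(2) by (auto simp: chain_rule_condition_def)
    ultimately have "ball (f z) (\<alpha> * \<rho>) \<subseteq> f ` ball z \<rho>"
      using continuous_on_subset[OF cont \<rho>(2)] \<rho>(1) \<open>0 < \<alpha>\<close> \<open>\<alpha> < \<beta>\<close> surj below
      by (intro linear_openness) blast+
    also have "\<dots> \<subseteq> f ` ?B" using sub by (rule image_mono)
    finally show "\<exists>e>0. ball p e \<subseteq> f ` ?B"
      using \<open>0 < \<alpha>\<close> \<rho>(1) z(2) by (intro exI[of _ "\<alpha> * \<rho>"]) simp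
  qed
  moreover have "homeomorphism ?B (f ` ?B) f ?h"
    using cont lipschitz_on_continuous_on[OF lip] inj
    by (auto simp: homeomorphism_def)
  ultimately show "\<exists>r>0. ball x r \<subseteq> U \<and> open (f ` ball x r) \<and>
       homeomorphism (ball x r) (f ` ball x r) f (inv_into (ball x r) f) \<and>
       (inverse \<alpha>)-lipschitz_on (f ` ball x r) (inv_into (ball x r) f)"
    using r lip by blast
qed

end
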